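(* Let $n\geq 1$. There is a constant $C$ depending only on $n$, and one may take $C=(2\pi e)^{\frac{n}{2}}$, such that the following holds for every probability density function $f$ on $\mathbb{R}^n$. (i) For $1<p<\infty$, if $f$ has finite covariance matrix $\Sigma$, then $$h_p(X)\leq \frac{1}{2}\log(\det\Sigma)+\log C.$$ (ii) For $0<p<1$, if $\|f\|_p<\infty$ and $f$ has finite $p$-covariance matrix $\Sigma_p$, then $$h_p(X)\leq \frac{1}{2}\log(\det\Sigma_p)+\log C.$$
   Context: All integrals are with respect to Lebesgue measure. For $0<p<\infty$, $\|f\|_p=\left(\int_{\mathbb{R}^n}|f(x)|^p\,d^nx\right)^{1/p}$. The Rényi entropy of order $p\neq 1$ of a random vector $X$ with density $f$ is $h_p(X)=\frac{p}{1-p}\log\|f\|_p$ (with $\log\infty=+\infty$, so $h_p(X)=-\infty$ if $p>1$ and $\|f\|_p=\infty$). For $q>0$ with $0<\|f\|_q<\infty$, the $q$-expectation is $$E_q[X]=\frac{\int_{\mathbb{R}^n}x|f(x)|^q\,d^nx}{\int_{\mathbb{R}^n}|f(x)|^q\,d^nx},$$ with the analogous formula for functions of $X$ (replace $x$ in the numerator by that function of $x$), and the $q$-covariance matrix is $\Sigma_q=E_q\left[(X-E_q[X])(X-E_q[X])^T\right]$. It is called finite when $\int_{\mathbb{R}^n}|x|^2|f(x)|^q\,d^nx<\infty$. For $q=1$, $\Sigma=\Sigma_1$ is the usual covariance matrix. *)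

theory Defs
  imports "HOL-Analysis.Analysis"
begin

definition prob_density :: "(real ^ 'n \<Rightarrow> real) \<Rightarrow> bool" where
  "prob_density f \<longleftrightarrow>
     f \<in> borel_measurable lebesgue \<and> (\<forall>x. 0 \<le> f x) \<and>
     (\<integral>\<^sup>+ x. ennreal (f x) \<partial>lebesgue) = 1"

text \<open>The real power \<open>powr\<close> is not available on \<^typ>\<open>ennreal\<close>, hence the case
  distinction: the norm is infinite iff the integral is.\<close>

definition lp_norm :: "real \<Rightarrow> (real ^ 'n \<Rightarrow> real) \<Rightarrow> ennreal" where
  "lp_norm p f =
     (let I = (\<integral>\<^sup>+ x. ennreal (\<bar>f x\<bar> powr p) \<partial>lebesgue)
      in if I = \<infinity> then \<infinity> else ennreal (enn2real I powr (1 / p)))"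

text \<open>Extended natural logarithm: \<open>log 0 = -\<infinity>\<close> and \<open>log \<infinity> = \<infinity>\<close>
  (whereas \<open>ln 0 = 0\<close> on the reals).\<close>

definition log_ext :: "ennreal \<Rightarrow> ereal" where
  "log_ext a = (if a = 0 then -\<infinity> else if a = \<infinity> then \<infinity> else ereal (ln (enn2real a)))"

definition renyi_entropy :: "real \<Rightarrow> (real ^ 'n \<Rightarrow> real) \<Rightarrow> ereal" where
  "renyi_entropy p f = ereal (p / (1 - p)) * log_ext (lp_norm p f)"

text \<open>\<open>q_expectation q f g\<close> is the $q$-expectation of \<open>g X\<close>, where \<open>X\<close> has density \<open>f\<close>;
  \<open>g\<close> may be vector- or matrix-valued (Bochner integral).\<close>

definition q_expectation ::
    "real \<Rightarrow> (real ^ 'n \<Rightarrow> real) \<Rightarrow>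
     (real ^ 'n \<Rightarrow> 'b :: {banach, second_countable_topology}) \<Rightarrow> 'b" where
  "q_expectation q f g =
     (LINT x|lebesgue. (\<bar>f x\<bar> powr q) *\<^sub>R g x) /\<^sub>R (LINT x|lebesgue. \<bar>f x\<bar> powr q)"

definition outer_prod :: "real ^ 'n \<Rightarrow> real ^ 'n \<Rightarrow> real ^ 'n ^ 'n" where
  "outer_prod u v = (\<chi> i j. u $ i * v $ j)"

definition q_covariance :: "real \<Rightarrow> (real ^ 'n \<Rightarrow> real) \<Rightarrow> real ^ 'n ^ 'n" where
  "q_covariance q f =
     (let m = q_expectation q f (\<lambda>x. x)
      in q_expectation q f (\<lambda>x. outer_prod (x - m) (x - m)))"

definition finite_q_covariance :: "real \<Rightarrow> (real ^ 'n \<Rightarrow> real) \<Rightarrow> bool" where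
  "finite_q_covariance q f \<longleftrightarrow>
     (\<integral>\<^sup>+ x. ennreal ((norm x)\<^sup>2 * \<bar>f x\<bar> powr q) \<partial>lebesgue) < \<infinity>"

end

(*
  For p > 1 let g be the Gaussian density with the mean and covariance of f. Jensen's inequality
  for exp gives ln (integral of f^p) >= (p - 1) * (integral of f ln f), and Gibbs' inequality
  bounds the last integral below by that of f ln g, which depends only on det Sigma. Both
  inequalities hold pointwise after linearization, so f ln f need not be integrable.
  To build g, choose A with A Sigma A^T = 1 by Gram-Schmidt for the inner product of Sigma and put
  g(x) = |det A| phi(A (x - m)), phi being the standard Gaussian.
  For p < 1, apply the first case to the escort density f^p / (integral of f^p) and the
  exponent 1/p: its covariance is the p-covariance of f, and its entropy of order 1/p is h_p(f).
*)
theory Submission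
  imports Defs "HOL-Probability.Distributions"
begin

section \<open>Linear change of variables for Lebesgue measure\<close>

lemma nn_integral_lborel_translation:
  fixes f :: "'a::euclidean_space \<Rightarrow> ennreal"
  assumes [measurable]: "f \<in> borel_measurable borel"
  shows "(\<integral>\<^sup>+x. f (c + x) \<partial>lborel) = (\<integral>\<^sup>+x. f x \<partial>lborel)"
proof -
  have "(\<integral>\<^sup>+x. f x \<partial>lborel) = (\<integral>\<^sup>+x. f x \<partial>distr lborel borel ((+) c))"
    by (simp add: lborel_distr_plus)
  then show ?thesis
    by (simp add: nn_integral_distr)
qed

lemma borel_measurable_matrix_vector_mult [measurable]:
  "(*v) (A :: real^'n^'m) \<in> borel_measurable borel"
  by (intro borel_measurable_continuous_onI linear_continuous_on matrix_vector_mul_bounded_linear)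

text \<open>Fubini for the convolution of \<open>f \<circ> A\<close> with the even function \<open>G\<close>.
  The library's change of variables theorem is not applicable: it needs a well-ordered index type.\<close>

lemma nn_integral_linear_image_scaling:
  fixes A :: "real^'n^'n"
  assumes "invertible A"
  obtains c :: ennreal where
    "\<And>f. f \<in> borel_measurable borel \<Longrightarrow>
       (\<integral>\<^sup>+x. f (A *v x) \<partial>lborel) = c * (\<integral>\<^sup>+x. f x \<partial>lborel)"
proof
  obtain B where AB: "A ** B = mat 1"
    using assms by (auto simp: invertible_def)
  \<comment> \<open>The argument uses three properties of \<open>G\<close>: it is Borel, it is even,
    and its integral is neither 0 nor infinite.\<close>
  define G :: "real^'n \<Rightarrow> ennreal" where "G = indicator (ball 0 1)"
  have [measurable]: "G \<in> borel_measurable borel"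
    unfolding G_def by (rule borel_measurable_indicator) simp
  have G_even: "G (- x) = G x" for x by (simp add: G_def indicator_def)
  have G_int: "(\<integral>\<^sup>+x. G x \<partial>lborel) = emeasure lborel (ball (0::real^'n) 1)"
    by (simp add: G_def)
  have pos: "(\<integral>\<^sup>+x. G x \<partial>lborel) \<noteq> 0"
    unfolding G_int using content_ball_pos[of 1 "0::real^'n"]
    by (auto simp: measure_def)
  have fin: "(\<integral>\<^sup>+x. G x \<partial>lborel) \<noteq> \<infinity>"
    unfolding G_int using emeasure_lborel_ball_finite[of "0::real^'n" 1] by simp
  fix f :: "real^'n \<Rightarrow> ennreal" assume [measurable]: "f \<in> borel_measurable borel"
  have "(\<integral>\<^sup>+x. f (A *v x) \<partial>lborel) * (\<integral>\<^sup>+x. G x \<partial>lborel)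
      = (\<integral>\<^sup>+y. (\<integral>\<^sup>+x. f (A *v x) * G y \<partial>lborel) \<partial>lborel)"
    by (simp add: nn_integral_multc nn_integral_cmult)
  \<comment> \<open>For fixed \<open>y\<close>, translating \<open>x\<close> by
    \<open>B *v y\<close> adds exactly \<open>y\<close> to \<open>A *v x\<close>, as
    \<open>A ** B = mat 1\<close>.\<close>
  also have "\<dots> = (\<integral>\<^sup>+y. (\<integral>\<^sup>+x. f (A *v (B *v y + x)) * G y \<partial>lborel) \<partial>lborel)"
    by (intro nn_integral_cong nn_integral_lborel_translation[symmetric]) simp
  also have "\<dots> = (\<integral>\<^sup>+y. (\<integral>\<^sup>+x. f (A *v x + y) * G y \<partial>lborel) \<partial>lborel)"
    by (simp add: matrix_vector_right_distrib matrix_vector_mul_assoc AB add.commute)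
  also have "\<dots> = (\<integral>\<^sup>+x. (\<integral>\<^sup>+y. f (A *v x + y) * G y \<partial>lborel) \<partial>lborel)"
    by (rule lborel_pair.Fubini') simp
  also have "\<dots> = (\<integral>\<^sup>+x. (\<integral>\<^sup>+y. f y * G (y - A *v x) \<partial>lborel) \<partial>lborel)"
  proof (rule nn_integral_cong)
    fix x
    show "(\<integral>\<^sup>+y. f (A *v x + y) * G y \<partial>lborel) = (\<integral>\<^sup>+y. f y * G (y - A *v x) \<partial>lborel)"
      using nn_integral_lborel_translation[of "\<lambda>y. f y * G (y - A *v x)" "A *v x"] by simp
  qed
  also have "\<dots> = (\<integral>\<^sup>+y. (\<integral>\<^sup>+x. f y * G (y - A *v x) \<partial>lborel) \<partial>lborel)"
    by (rule lborel_pair.Fubini') simp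
  \<comment> \<open>The same translation now turns \<open>y - A *v x\<close> into
    \<open>- (A *v x)\<close>, which separates the variables; evenness of \<open>G\<close> removes
    the sign.\<close>
  also have "\<dots> = (\<integral>\<^sup>+y. (\<integral>\<^sup>+x. f y * G (y - A *v (B *v y + x)) \<partial>lborel) \<partial>lborel)"
    by (intro nn_integral_cong nn_integral_lborel_translation[symmetric]) simp
  also have "\<dots> = (\<integral>\<^sup>+y. (\<integral>\<^sup>+x. f y * G (A *v x) \<partial>lborel) \<partial>lborel)"
    by (simp add: matrix_vector_right_distrib matrix_vector_mul_assoc AB G_even)
  also have "\<dots> = (\<integral>\<^sup>+x. f x \<partial>lborel) * (\<integral>\<^sup>+x. G (A *v x) \<partial>lborel)"
    by (simp add: nn_integral_multc nn_integral_cmult)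
  finally have eq: "(\<integral>\<^sup>+x. f (A *v x) \<partial>lborel) * (\<integral>\<^sup>+x. G x \<partial>lborel)
      = (\<integral>\<^sup>+x. f x \<partial>lborel) * (\<integral>\<^sup>+x. G (A *v x) \<partial>lborel)" .
  \<comment> \<open>The witness for \<open>c\<close> is the quotient of the integrals of
    \<open>G \<circ> A\<close> and \<open>G\<close>, which does not depend on \<open>f\<close>. Its
    numerator is not shown to be finite here, so \<open>c\<close> stays in
    \<open>ennreal\<close>.\<close>
  show "(\<integral>\<^sup>+x. f (A *v x) \<partial>lborel)
      = (\<integral>\<^sup>+x. G (A *v x) \<partial>lborel) / (\<integral>\<^sup>+x. G x \<partial>lborel) * (\<integral>\<^sup>+x. f x \<partial>lborel)"
    unfolding mult.commute[of "_ / _"] ennreal_times_divide eq[symmetric]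
    using pos fin by (intro mult_divide_eq_ennreal[symmetric]) auto
qed

definition scales_lborel :: "real^'n^'n \<Rightarrow> bool" where
  "scales_lborel A \<longleftrightarrow> det A = 0 \<or>
     (\<forall>f \<in> borel_measurable borel.
        ennreal \<bar>det A\<bar> * (\<integral>\<^sup>+x. f (A *v x) \<partial>lborel) = (\<integral>\<^sup>+x. f x \<partial>lborel))"

lemma scales_lborel_mult:
  assumes A: "scales_lborel A" and B: "scales_lborel B"
  shows "scales_lborel (A ** B)"
proof (cases "det (A ** B) = 0")
  case False
  then have nz: "det A \<noteq> 0" "det B \<noteq> 0" by (auto simp: det_mul)
  have "ennreal \<bar>det (A ** B)\<bar> * (\<integral>\<^sup>+x. f ((A ** B) *v x) \<partial>lborel) = (\<integral>\<^sup>+x. f x \<partial>lborel)"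
    if [measurable]: "f \<in> borel_measurable borel" for f
  proof -
    have "ennreal \<bar>det (A ** B)\<bar> * (\<integral>\<^sup>+x. f ((A ** B) *v x) \<partial>lborel)
        = ennreal \<bar>det A\<bar> * (ennreal \<bar>det B\<bar> * (\<integral>\<^sup>+x. f (A *v (B *v x)) \<partial>lborel))"
      by (simp add: det_mul abs_mult ennreal_mult' matrix_vector_mul_assoc mult.assoc)
    also have "ennreal \<bar>det B\<bar> * (\<integral>\<^sup>+x. f (A *v (B *v x)) \<partial>lborel) = (\<integral>\<^sup>+x. f (A *v x) \<partial>lborel)"
      using B nz unfolding scales_lborel_def by (auto dest!: bspec[where x="\<lambda>x. f (A *v x)"])
    also have "ennreal \<bar>det A\<bar> * (\<integral>\<^sup>+x. f (A *v x) \<partial>lborel) = (\<integral>\<^sup>+x. f x \<partial>lborel)"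
      using A nz that unfolding scales_lborel_def by auto
    finally show ?thesis .
  qed
  then show ?thesis by (simp add: scales_lborel_def)
qed (simp add: scales_lborel_def)

text \<open>The scaling factor \<open>c\<close> of an involution satisfies \<open>c\<^sup>2 = 1\<close>. A shear is the product of a
  diagonal reflection and an involution, so only diagonal matrices need a computation.\<close>

lemma scales_lborel_involution:
  fixes A :: "real^'n^'n"
  assumes AA': "\<And>x. A *v (A *v x) = x"
  shows "scales_lborel A"
proof -
  have AA: "A ** A = mat 1"
    by (simp add: matrix_eq AA' flip: matrix_vector_mul_assoc)
  have "det A * det A = 1"
    using det_mul[of A A] by (simp add: AA)
  then have det: "\<bar>det A\<bar> = 1"
    by (metis abs_1 abs_mult_self_eq abs_square_eq_1 power2_eq_square)
  have "invertible A" using AA by (auto simp: invertible_def)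
  then obtain c where c: "\<And>f. f \<in> borel_measurable borel \<Longrightarrow>
       (\<integral>\<^sup>+x. f (A *v x) \<partial>lborel) = c * (\<integral>\<^sup>+x. f x \<partial>lborel)"
    by (rule nn_integral_linear_image_scaling) blast
  \<comment> \<open>The unit cube has measure 1, so applying the scaling rule twice to
    \<open>?U\<close> leaves just \<open>c * c\<close>.\<close>
  let ?U = "indicator (cbox 0 One) :: real^'n \<Rightarrow> ennreal"
  have U: "(\<integral>\<^sup>+x. ?U x \<partial>lborel) = 1"
    by (simp add: emeasure_lborel_cbox_eq)
  have "1 = (\<integral>\<^sup>+x. ?U (A *v (A *v x)) \<partial>lborel)"
    by (simp add: matrix_vector_mul_assoc AA U)
  also have "\<dots> = c * c"
    using c[of "\<lambda>x. ?U (A *v x)"] c[of ?U] U by simp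
  finally have cc: "c * c = 1" by simp
  have "c = 1"
  proof (cases c)
    case (real r)
    then have "ennreal (r * r) = 1" using cc by (simp add: ennreal_mult)
    then have "r * r = 1" by (simp only: ennreal_eq_1)
    then show ?thesis
      using real by (metis abs_mult_self_eq abs_of_nonneg abs_square_eq_1 power2_eq_square ennreal_1)
  next
    case top
    then show ?thesis using cc by simp
  qed
  then show ?thesis using c det by (simp add: scales_lborel_def)
qed

text \<open>A diagonal matrix rescales each coordinate separately, which is the situation of
  \<open>lborel_affine_euclidean\<close>; the work lies in translating between coordinates and
  \<open>Basis\<close>.\<close>

lemma scales_lborel_diagonal:
  fixes A :: "real^'n^'n"
  assumes diag: "\<And>i j. i \<noteq> j \<Longrightarrow> A $ i $ j = 0"
  shows "scales_lborel A"
proof (cases "det A = 0")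
  case False
  have det: "det A = (\<Prod>i\<in>UNIV. A $ i $ i)"
    by (rule det_diagonal) (rule diag)
  \<comment> \<open>The library indexes scale factors by basis vectors instead of coordinates. On
    \<open>axis i 1\<close> this expression returns the diagonal entry.\<close>
  define c where "c b = (A *v b) \<bullet> b" for b :: "real^'n"
  have c_axis: "c (axis i 1) = A $ i $ i" for i
    by (simp add: c_def matrix_vector_mult_basis inner_axis column_def)
  have inj: "inj (\<lambda>i::'n. axis i (1::real))"
    by (auto simp: inj_def axis_eq_axis)
  have Basis: "(Basis :: (real^'n) set) = (\<lambda>i. axis i 1) ` UNIV"
    by (auto simp: Basis_vec_def)
  have diag_sum: "(\<Sum>j\<in>UNIV. A $ i $ j * x $ j) = A $ i $ i * x $ i" for i and x :: "real^'n"
  proof -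
    have "(\<Sum>j\<in>UNIV. A $ i $ j * x $ j) = (\<Sum>j\<in>UNIV. if j = i then A $ i $ i * x $ i else 0)"
      using diag[of i] by (intro sum.cong) auto
    then show ?thesis by simp
  qed
  have axis_sum: "(\<Sum>i\<in>UNIV. A $ i $ i * x $ i * axis i 1 $ k) = A $ k $ k * x $ k" for k and x :: "real^'n"
  proof -
    have "A $ i $ i * x $ i * axis i 1 $ k = (if i = k then A $ k $ k * x $ k else 0)" for i
      by (simp add: axis_def)
    then show ?thesis by simp
  qed
  \<comment> \<open>The leading 0 is the translation part of the library's affine map.\<close>
  have T: "0 + (\<Sum>j\<in>Basis. (c j * (x \<bullet> j)) *\<^sub>R j) = A *v x" for x
    unfolding Basis using inj
    by (simp add: sum.reindex c_axis vec_eq_iff matrix_vector_mult_def inner_axis axis_sum diag_sum)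
  have prod: "(\<Prod>j\<in>Basis. \<bar>c j\<bar>) = \<bar>det A\<bar>"
    unfolding Basis using inj by (simp add: prod.reindex c_axis det abs_prod)
  have "c j \<noteq> 0" if "j \<in> Basis" for j
    using that False by (auto simp: Basis c_axis det)
  then have lb: "lborel = density (distr lborel borel ((*v) A)) (\<lambda>_. ennreal \<bar>det A\<bar>)"
    using lborel_affine_euclidean[of c 0, unfolded T prod] by blast
  have "ennreal \<bar>det A\<bar> * (\<integral>\<^sup>+x. f (A *v x) \<partial>lborel) = (\<integral>\<^sup>+x. f x \<partial>lborel)"
    if [measurable]: "f \<in> borel_measurable borel" for f
    by (subst (2) lb) (simp add: nn_integral_density nn_integral_distr nn_integral_cmult)
  then show ?thesis by (simp add: scales_lborel_def)
qed (simp add: scales_lborel_def)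

text \<open>Every matrix is built by products from matrices with a zero row, diagonal matrices,
  transpositions and shears. A zero row makes the determinant vanish, so that case is
  vacuous.\<close>

lemma scales_lborel_matrix: "scales_lborel (A :: real^'n^'n)"
proof (induction A rule: induct_matrix_elementary_alt)
  case (1 A B) then show ?case by (rule scales_lborel_mult)
next
  case (2 A i) then show ?case by (simp add: scales_lborel_def det_zero_row)
next
  case (3 A) then show ?case by (rule scales_lborel_diagonal)
next
  case (4 m n)
  \<comment> \<open>This matrix swaps coordinates \<open>m\<close> and \<open>n\<close>, hence is an
    involution.\<close>
  let ?S = "(\<chi> i j. mat 1 $ i $ Transposition.transpose m n j) :: real^'n^'n"
  have "mat 1 $ i $ Transposition.transpose m n j * x $ j
      = (if j = Transposition.transpose m n i then x $ j else 0)" for i j and x :: "real^'n"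
    by (auto simp: mat_def)
  then have S: "?S *v x = (\<chi> i. x $ Transposition.transpose m n i)" for x
    by (simp add: vec_eq_iff matrix_vector_mult_def)
  show ?case
    by (rule scales_lborel_involution) (simp add: S)
next
  case (5 m n)
  let ?T = "(\<chi> i j. of_bool (i = m \<and> j = n \<or> i = j)) :: real^'n^'n"
  \<comment> \<open>\<open>?D\<close> negates coordinate \<open>m\<close>. Then
    \<open>?D ** ?T\<close> replaces \<open>x $ m\<close> by \<open>- (x $ m + x $ n)\<close>, which
    undoes itself because \<open>m\<close> and \<open>n\<close> differ, and \<open>?T\<close> is
    recovered by multiplying with \<open>?D\<close> once more.\<close>
  let ?D = "(\<chi> i j. if i = j then if i = m then - 1 else 1 else 0) :: real^'n^'n"
  have "(if i = j then if i = m then - 1 else 1 else 0) * x $ j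
      = (if j = i then if i = m then - x $ j else x $ j else 0)" for i j and x :: "real^'n"
    by auto
  then have D: "?D *v x = (\<chi> i. if i = m then - x $ i else x $ i)" for x
    by (simp add: vec_eq_iff matrix_vector_mult_def)
  have "(\<Sum>j\<in>UNIV. of_bool (i = m \<and> j = n \<or> i = j) * x $ j)
      = (if i = m then x $ m + x $ n else x $ i)" for i and x :: "real^'n"
  proof -
    have "of_bool (i = m \<and> j = n \<or> i = j) * x $ j
        = (if j = i then x $ j else 0) + (if j = n then if i = m then x $ j else 0 else 0)" for j
      using 5 by auto
    then show ?thesis
      by (simp add: sum.distrib)
  qed
  then have T: "?T *v x = (\<chi> i. if i = m then x $ m + x $ n else x $ i)" for x
    by (simp add: vec_eq_iff matrix_vector_mult_def)
  have "scales_lborel ?D"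
    by (rule scales_lborel_involution) (auto simp: D vec_eq_iff)
  moreover have "scales_lborel (?D ** ?T)"
  proof (rule scales_lborel_involution)
    fix x
    have DT: "(?D ** ?T) *v x = (\<chi> i. if i = m then - (x $ m + x $ n) else x $ i)" for x
      unfolding matrix_vector_mul_assoc[symmetric] T D by (simp add: vec_eq_iff)
    show "(?D ** ?T) *v ((?D ** ?T) *v x) = x"
      unfolding DT using 5 by (simp add: vec_eq_iff)
  qed
  ultimately have "scales_lborel (?D ** (?D ** ?T))"
    by (rule scales_lborel_mult)
  moreover have "?D ** (?D ** ?T) = ?T"
    unfolding matrix_eq matrix_vector_mul_assoc[symmetric] D by (simp add: vec_eq_iff)
  ultimately show ?case by simp
qed


lemma nn_integral_lborel_matrix:
  fixes A :: "real^'n^'n"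
  assumes "det A \<noteq> 0" and "f \<in> borel_measurable borel"
  shows "ennreal \<bar>det A\<bar> * (\<integral>\<^sup>+x. f (A *v x) \<partial>lborel) = (\<integral>\<^sup>+x. f x \<partial>lborel)"
  using scales_lborel_matrix[of A] assms by (auto simp: scales_lborel_def)

section \<open>Gaussian densities\<close>

definition std_gaussian :: "real^'n \<Rightarrow> real" where
  "std_gaussian x = (\<Prod>i\<in>UNIV. std_normal_density (x $ i))"

lemma std_gaussian_pos: "0 < std_gaussian x"
  by (auto simp: std_gaussian_def intro!: prod_pos normal_density_pos)

lemma borel_measurable_std_gaussian [measurable]: "std_gaussian \<in> borel_measurable borel"
  unfolding std_gaussian_def by measurable

lemma ln_std_gaussian:
  fixes x :: "real^'n"
  shows "ln (std_gaussian x) = - (real CARD('n) / 2 * ln (2 * pi)) - (norm x)\<^sup>2 / 2"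
proof -
  have "ln (std_gaussian x) = (\<Sum>i\<in>UNIV. ln (std_normal_density (x $ i)))"
    unfolding std_gaussian_def by (rule ln_prod) (auto simp: less_imp_neq[OF normal_density_pos, symmetric])
  also have "\<dots> = (\<Sum>i\<in>UNIV. - (ln (2 * pi) / 2) - (x $ i)\<^sup>2 / 2)"
    by (intro sum.cong refl) (simp add: std_normal_density_def ln_mult ln_div ln_sqrt)
  also have "\<dots> = - (real CARD('n) / 2 * ln (2 * pi)) - (norm x)\<^sup>2 / 2"
    by (simp add: sum_subtractf sum_negf norm_vec_def L2_set_def sum_nonneg flip: sum_divide_distrib)
  finally show ?thesis .
qed

text \<open>By Tonelli the integral factorizes over the standard basis into one-dimensional normal
  integrals, each equal to 1.\<close>

lemma nn_integral_std_gaussian: "(\<integral>\<^sup>+x. ennreal (std_gaussian (x :: real^'n)) \<partial>lborel) = 1"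
proof -
  have inj: "inj (\<lambda>i::'n. axis i (1::real))"
    by (auto simp: inj_def axis_eq_axis)
  have Basis: "(Basis :: (real^'n) set) = (\<lambda>i. axis i 1) ` UNIV"
    by (auto simp: Basis_vec_def)
  have "ennreal (std_gaussian x) = (\<Prod>b\<in>Basis. ennreal (std_normal_density (x \<bullet> b)))" for x :: "real^'n"
    unfolding Basis using inj
    by (simp add: std_gaussian_def prod.reindex inner_axis prod_ennreal)
  moreover have "(\<integral>\<^sup>+x. ennreal (std_normal_density x) \<partial>lborel) = 1"
    by (subst nn_integral_eq_integral) auto
  ultimately show ?thesis
    using nn_integral_lborel_prod[where f="\<lambda>(_ :: real^'n) t. ennreal (std_normal_density t)"] by simp
qed

text \<open>Translation invariance removes \<open>m\<close>, and \<open>\<bar>det A\<bar>\<close> is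
  the Jacobian of \<open>x \<mapsto> A *v x\<close>. The integrand is Borel, so passing between
  \<open>lebesgue\<close> and \<open>lborel\<close> does not change the integral.\<close>

lemma nn_integral_gaussian:
  fixes A :: "real^'n^'n"
  assumes "det A \<noteq> 0"
  shows "(\<integral>\<^sup>+x. ennreal (\<bar>det A\<bar> * std_gaussian (A *v (x - m))) \<partial>lebesgue) = 1"
proof -
  have "(\<integral>\<^sup>+x. ennreal (\<bar>det A\<bar> * std_gaussian (A *v (x - m))) \<partial>lebesgue)
      = (\<integral>\<^sup>+x. ennreal \<bar>det A\<bar> * ennreal (std_gaussian (A *v (- m + x))) \<partial>lborel)"
    by (simp add: nn_integral_completion ennreal_mult')
  also have "\<dots> = ennreal \<bar>det A\<bar> * (\<integral>\<^sup>+x. ennreal (std_gaussian (A *v (- m + x))) \<partial>lborel)"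
    by (rule nn_integral_cmult) measurable
  also have "(\<integral>\<^sup>+x. ennreal (std_gaussian (A *v (- m + x))) \<partial>lborel)
      = (\<integral>\<^sup>+x. ennreal (std_gaussian (A *v x)) \<partial>lborel)"
    by (rule nn_integral_lborel_translation) measurable
  also have "ennreal \<bar>det A\<bar> * \<dots> = 1"
    using nn_integral_lborel_matrix[OF assms, of "\<lambda>x. ennreal (std_gaussian x)"]
    by (simp add: nn_integral_std_gaussian)
  finally show ?thesis .
qed

section \<open>Lower bound for the integral of a power by a cross entropy\<close>

text \<open>The tangent of \<open>exp\<close> at \<open>l\<close>, evaluated at \<open>(p - 1) * ln a\<close>, combined with
  \<open>a * ln a \<ge> a * ln g + a - g\<close>.\<close>

lemma powr_ge_cross_entropy_tangent:
  fixes a g p l :: real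
  assumes "0 \<le> a" "0 < g" "1 < p"
  shows "exp l * (a + (p - 1) * (a * ln g + a - g) - l * a) \<le> a powr p"
proof (cases "a = 0")
  case True
  then show ?thesis using assms by (simp add: mult_nonneg_nonneg)
next
  case False
  then have a: "0 < a" using assms by simp
  have "ln (g / a) \<le> g / a - 1"
    using a assms by (intro ln_le_minus_one) simp
  then have "a * (ln g - ln a) \<le> a * (g / a - 1)"
    using a assms by (intro mult_left_mono) (simp_all add: ln_div)
  then have "a * ln g + a - g \<le> a * ln a"
    using a by (simp add: algebra_simps)
  then have "(p - 1) * (a * ln g + a - g) \<le> (p - 1) * (a * ln a)"
    using assms by (intro mult_left_mono) simp_all
  then have "exp l * (a + (p - 1) * (a * ln g + a - g) - l * a)
      \<le> exp l * (a + (p - 1) * (a * ln a) - l * a)"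
    by simp
  also have "\<dots> = a * (exp l * (1 + ((p - 1) * ln a - l)))"
    by (simp add: algebra_simps)
  also have "\<dots> \<le> a * (exp l * exp ((p - 1) * ln a - l))"
    using a by (intro mult_left_mono exp_ge_add_one_self) simp_all
  also have "\<dots> = exp (ln a) * exp ((p - 1) * ln a)"
    using a by (simp flip: exp_add)
  also have "\<dots> = a powr p"
    using a by (simp add: powr_def mult_exp_exp algebra_simps del: exp_ln)
  finally show ?thesis .
qed

text \<open>Jensen and Gibbs in one step: the pointwise tangent inequality is integrated, with no
  integral of \<open>f * ln f\<close> involved. If the power integral is infinite, the bound is
  trivial.\<close>

lemma exp_cross_entropy_le_powr_integral:
  fixes f g :: "'a \<Rightarrow> real"
  assumes "1 < p"
    and f: "integrable M f" "\<And>x. 0 \<le> f x" "(\<integral>x. f x \<partial>M) = 1"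
    and g: "integrable M g" "\<And>x. 0 < g x" "(\<integral>x. g x \<partial>M) = 1"
    and fg: "integrable M (\<lambda>x. f x * ln (g x))"
  shows "ennreal (exp ((p - 1) * (\<integral>x. f x * ln (g x) \<partial>M))) \<le> (\<integral>\<^sup>+x. ennreal (f x powr p) \<partial>M)"
proof (cases "(\<integral>\<^sup>+x. ennreal (f x powr p) \<partial>M) = \<infinity>")
  case False
  have [measurable]: "f \<in> borel_measurable M" using f by auto
  have fp: "integrable M (\<lambda>x. f x powr p)"
    using False by (intro integrableI_nonneg) (auto simp: top.not_eq_extremum)
  \<comment> \<open>With this tangent point the first-order terms cancel: as \<open>f\<close> and
    \<open>g\<close> both integrate to 1, the bracket integrates to \<open>1 + l - l = 1\<close>,
    and only \<open>exp l\<close> remains.\<close>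
  define l where "l = (p - 1) * (\<integral>x. f x * ln (g x) \<partial>M)"
  have "exp l = (\<integral>x. exp l * (f x + (p - 1) * (f x * ln (g x) + f x - g x) - l * f x) \<partial>M)"
    using f g fg by (simp add: l_def)
  also have "\<dots> \<le> (\<integral>x. f x powr p \<partial>M)"
    using f g fg fp assms(1) by (intro integral_mono powr_ge_cross_entropy_tangent) auto
  finally have "ennreal (exp l) \<le> ennreal (\<integral>x. f x powr p \<partial>M)"
    by (rule ennreal_leI)
  also have "\<dots> = (\<integral>\<^sup>+x. ennreal (f x powr p) \<partial>M)"
    using fp by (intro nn_integral_eq_integral[symmetric]) auto
  finally show ?thesis by (simp add: l_def)
qed simp

section \<open>Gram-Schmidt and whitening\<close>

text \<open>Gram-Schmidt for the inner product \<open>a \<bullet> (S *v b)\<close>, adding one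
  vector at a time; the size \<open>k\<close> is kept general for the induction.\<close>

lemma orthonormal_set_exists:
  fixes S :: "real^'n^'n"
  assumes sym: "\<And>a b. a \<bullet> (S *v b) = b \<bullet> (S *v a)"
    and pos: "\<And>a. a \<noteq> 0 \<Longrightarrow> 0 < a \<bullet> (S *v a)"
    and "k \<le> CARD('n)"
  shows "\<exists>B. finite B \<and> card B = k \<and> (\<forall>a\<in>B. \<forall>b\<in>B. a \<bullet> (S *v b) = of_bool (a = b))"
  using assms(3)
proof (induction k)
  case 0
  show ?case by (intro exI[of _ "{}"]) simp
next
  case (Suc k)
  then obtain B where B: "finite B" "card B = k"
    and ortho: "\<And>a b. a \<in> B \<Longrightarrow> b \<in> B \<Longrightarrow> a \<bullet> (S *v b) = of_bool (a = b)"
    by (meson Suc_leD)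
  \<comment> \<open>Fewer than \<open>CARD('n)\<close> vectors cannot span the space, so there is a
    direction left to orthogonalize.\<close>
  have "dim (span B) < DIM(real^'n)"
    using dim_le_card'[OF B(1)] B(2) Suc.prems by simp
  then have "span B \<noteq> UNIV"
    by (metis dim_UNIV less_irrefl)
  then obtain v where v: "v \<notin> span B" by blast
  \<comment> \<open>The vector \<open>v\<close> minus its \<open>S\<close>-orthogonal projection
    onto \<open>span B\<close>. It is nonzero because \<open>v\<close> lies outside that
    span.\<close>
  define w where "w = v - (\<Sum>s\<in>B. (s \<bullet> (S *v v)) *\<^sub>R s)"
  have "(\<Sum>s\<in>B. (s \<bullet> (S *v v)) *\<^sub>R s) \<in> span B"
    by (intro span_sum span_scale span_base)
  then have "w \<noteq> 0" using v by (auto simp: w_def)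
  then have w_pos: "0 < w \<bullet> (S *v w)" by (rule pos)
  have w_ortho: "w \<bullet> (S *v t) = 0" if "t \<in> B" for t
  proof -
    have "(\<Sum>s\<in>B. (s \<bullet> (S *v v)) * (s \<bullet> (S *v t))) = (\<Sum>s\<in>B. if s = t then t \<bullet> (S *v v) else 0)"
      using that by (intro sum.cong) (auto simp: ortho)
    then have "(\<Sum>s\<in>B. (s \<bullet> (S *v v)) * (s \<bullet> (S *v t))) = t \<bullet> (S *v v)"
      using that B by simp
    then show ?thesis
      by (simp add: w_def inner_diff_left inner_sum_left sym[of v])
  qed
  define u where "u = (1 / sqrt (w \<bullet> (S *v w))) *\<^sub>R w"
  have uu: "u \<bullet> (S *v u) = 1"
    using w_pos by (simp add: u_def matrix_vector_mult_scaleR flip: power2_eq_square)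
  have ut: "u \<bullet> (S *v t) = 0" "t \<bullet> (S *v u) = 0" if "t \<in> B" for t
    using w_ortho[OF that] sym[of t u] by (simp_all add: u_def)
  \<comment> \<open>Otherwise \<open>u \<bullet> (S *v u)\<close> would be both 0 and 1. This makes
    the cardinality grow by exactly one.\<close>
  have "u \<notin> B" using ut uu by force
  then show ?case
    using B ortho uu ut by (intro exI[of _ "insert u B"]) auto
qed

text \<open>The rows of \<open>A\<close> are a full \<open>S\<close>-orthonormal set, so
  \<open>A ** S ** transpose A\<close> is the identity; taking determinants gives the second claim.
  The row form of the first claim says that the coordinates of \<open>A *v X\<close> are
  uncorrelated with variance 1 when \<open>X\<close> has covariance \<open>S\<close>.\<close>

lemma whitening_matrix_exists:
  fixes S :: "real^'n^'n"
  assumes sym: "\<And>a b. a \<bullet> (S *v b) = b \<bullet> (S *v a)"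
    and pos: "\<And>a. a \<noteq> 0 \<Longrightarrow> 0 < a \<bullet> (S *v a)"
  obtains A :: "real^'n^'n" where
    "\<And>i j. A $ i \<bullet> (S *v A $ j) = of_bool (i = j)" and "(det A)\<^sup>2 * det S = 1"
proof -
  obtain B where B: "finite B" "card B = CARD('n)"
    and ortho: "\<forall>a\<in>B. \<forall>b\<in>B. a \<bullet> (S *v b) = of_bool (a = b)"
    using orthonormal_set_exists[OF sym pos, of "CARD('n)"] by blast
  obtain e where e: "bij_betw e (UNIV :: 'n set) B"
    using finite_same_card_bij[of "UNIV :: 'n set" B] B by auto
  define A :: "real^'n^'n" where "A = (\<chi> i. e i)"
  have A: "A $ i \<bullet> (S *v A $ j) = of_bool (i = j)" for i j
    using ortho e by (auto simp: A_def bij_betw_def inj_def)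
  have "(A ** (S ** transpose A)) $ i $ j = A $ i \<bullet> (S *v A $ j)" for i j
    by (simp add: matrix_matrix_mult_def matrix_vector_mult_def inner_vec_def transpose_def)
  then have "A ** (S ** transpose A) = mat 1"
    by (simp add: vec_eq_iff A mat_def)
  then have "det (A ** (S ** transpose A)) = 1" by simp
  then have "(det A)\<^sup>2 * det S = 1"
    by (simp add: det_mul power2_eq_square mult_ac)
  with A show ?thesis by (rule that)
qed

section \<open>Covariance of a density with finite second moment\<close>

lemma norm_outer_prod: "norm (outer_prod u v) = norm u * norm v"
proof -
  have "outer_prod u v $ i = (u $ i) *\<^sub>R v" for i
    by (simp add: outer_prod_def vec_eq_iff)
  then show ?thesis
    by (simp add: norm_vec_def[of "outer_prod u v"] norm_vec_def[of u] L2_set_left_distrib)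
qed

lemma outer_prod_mult_vec: "outer_prod u v *v b = (v \<bullet> b) *\<^sub>R u"
  by (simp add: outer_prod_def matrix_vector_mult_def vec_eq_iff inner_vec_def sum_distrib_left mult_ac)

lemma borel_measurable_outer_prod [measurable]:
  "(\<lambda>x. outer_prod (x - m) (x - m)) \<in> borel_measurable borel"
  unfolding outer_prod_def
  by (intro borel_measurable_continuous_onI continuous_intros)

lemma borel_measurable_lebesgueI:
  "f \<in> borel_measurable borel \<Longrightarrow> f \<in> borel_measurable lebesgue"
  by (simp add: measurable_completion)

lemma prob_density_measurable: "prob_density f \<Longrightarrow> f \<in> borel_measurable lebesgue"
  and prob_density_nonneg: "prob_density f \<Longrightarrow> 0 \<le> f x"
  by (simp_all add: prob_density_def)

context
  fixes f :: "real^'n \<Rightarrow> real"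
  assumes density: "prob_density f" and finite: "finite_q_covariance 1 f"
begin

lemma density_integrable: "integrable lebesgue f"
  using density by (intro integrableI_nonneg) (auto simp: prob_density_def)

lemma density_integral: "(\<integral>x. f x \<partial>lebesgue) = 1"
  using density by (subst integral_eq_nn_integral) (auto simp: prob_density_def)

lemma second_moment_integrable: "integrable lebesgue (\<lambda>x. (norm x)\<^sup>2 * f x)"
proof (rule integrableI_nonneg)
  note [measurable] = prob_density_measurable[OF density]
  have [measurable]: "(\<lambda>x::real^'n. (norm x)\<^sup>2) \<in> borel_measurable lebesgue"
    by (intro borel_measurable_lebesgueI) measurable
  show "(\<lambda>x. (norm x)\<^sup>2 * f x) \<in> borel_measurable lebesgue"
    by measurable
qed (use finite prob_density_nonneg[OF density] in \<open>auto simp: finite_q_covariance_def\<close>)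

text \<open>The norm of the outer product is \<open>(norm (x - m))\<^sup>2\<close>, which is at most
  \<open>2 * (norm x)\<^sup>2 + 2 * (norm m)\<^sup>2\<close>; both terms are integrable against
  \<open>f\<close>.\<close>

lemma outer_prod_integrable:
  "integrable lebesgue (\<lambda>x. f x *\<^sub>R outer_prod (x - m) (x - m))"
proof (rule Bochner_Integration.integrable_bound)
  show "integrable lebesgue (\<lambda>x. 2 * ((norm x)\<^sup>2 * f x) + 2 * (norm m)\<^sup>2 * f x)"
    using second_moment_integrable density_integrable by auto
  note [measurable] = prob_density_measurable[OF density]
  have [measurable]: "(\<lambda>x. outer_prod (x - m) (x - m)) \<in> borel_measurable lebesgue"
    by (intro borel_measurable_lebesgueI) measurable
  show "(\<lambda>x. f x *\<^sub>R outer_prod (x - m) (x - m)) \<in> borel_measurable lebesgue"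
    by measurable
  show "AE x in lebesgue. norm (f x *\<^sub>R outer_prod (x - m) (x - m))
      \<le> norm (2 * ((norm x)\<^sup>2 * f x) + 2 * (norm m)\<^sup>2 * f x)"
  proof (rule AE_I2)
    fix x
    have "(norm (x - m))\<^sup>2 \<le> (norm x + norm m)\<^sup>2"
      by (intro power_mono norm_triangle_ineq4) simp
    also have "\<dots> \<le> 2 * (norm x)\<^sup>2 + 2 * (norm m)\<^sup>2"
      using zero_le_power2[of "norm x - norm m"] by (simp add: power2_eq_square algebra_simps)
    finally have "f x * (norm (x - m))\<^sup>2 \<le> f x * (2 * (norm x)\<^sup>2 + 2 * (norm m)\<^sup>2)"
      by (intro mult_left_mono prob_density_nonneg[OF density])
    then show "norm (f x *\<^sub>R outer_prod (x - m) (x - m))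
      \<le> norm (2 * ((norm x)\<^sup>2 * f x) + 2 * (norm m)\<^sup>2 * f x)"
      using prob_density_nonneg[OF density, of x] by (simp add: norm_outer_prod power2_eq_square algebra_simps)
  qed
qed

lemma q_expectation_density: "q_expectation 1 f g = (\<integral>x. f x *\<^sub>R g x \<partial>lebesgue)"
  using prob_density_nonneg[OF density] by (simp add: q_expectation_def density_integral)

text \<open>The map \<open>M \<mapsto> a \<bullet> (M *v b)\<close> is bounded linear and so
  commutes with the Bochner integral. This reduces the matrix-valued integral to scalar
  ones.\<close>

lemma covariance_bilinear:
  fixes a b :: "real^'n"
  defines "m \<equiv> q_expectation 1 f (\<lambda>x. x)"
  shows "integrable lebesgue (\<lambda>x. f x * ((a \<bullet> (x - m)) * (b \<bullet> (x - m))))"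
    and "a \<bullet> (q_covariance 1 f *v b) = (\<integral>x. f x * ((a \<bullet> (x - m)) * (b \<bullet> (x - m))) \<partial>lebesgue)"
proof -
  have "linear (\<lambda>M :: real^'n^'n. a \<bullet> (M *v b))"
    by (intro linearI) (simp_all add: matrix_vector_mult_add_rdistrib inner_add_right scaleR_matrix_vector_assoc[symmetric])
  then have bl: "bounded_linear (\<lambda>M :: real^'n^'n. a \<bullet> (M *v b))"
    by (simp add: linear_conv_bounded_linear)
  have eq: "a \<bullet> ((f x *\<^sub>R outer_prod (x - m) (x - m)) *v b) = f x * ((a \<bullet> (x - m)) * (b \<bullet> (x - m)))" for x
    by (simp add: outer_prod_mult_vec inner_commute mult_ac flip: scaleR_matrix_vector_assoc)
  show "integrable lebesgue (\<lambda>x. f x * ((a \<bullet> (x - m)) * (b \<bullet> (x - m))))"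
    using integrable_bounded_linear[OF bl outer_prod_integrable[of m]] by (simp add: eq)
  show "a \<bullet> (q_covariance 1 f *v b) = (\<integral>x. f x * ((a \<bullet> (x - m)) * (b \<bullet> (x - m))) \<partial>lebesgue)"
  proof -
    have "q_covariance 1 f = (\<integral>x. f x *\<^sub>R outer_prod (x - m) (x - m) \<partial>lebesgue)"
      by (simp add: q_covariance_def q_expectation_density Let_def m_def)
    then have "a \<bullet> (q_covariance 1 f *v b)
        = (\<integral>x. a \<bullet> ((f x *\<^sub>R outer_prod (x - m) (x - m)) *v b) \<partial>lebesgue)"
      by (simp only: integral_bounded_linear[OF bl outer_prod_integrable[of m]])
    then show ?thesis by (simp only: eq)
  qed
qed

text \<open>If the variance in direction \<open>a\<close> vanished, \<open>f\<close> would be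
  concentrated on the hyperplane through the mean orthogonal to \<open>a\<close>. That is a null
  set, contradicting total mass 1.\<close>

lemma covariance_pos_def:
  assumes "a \<noteq> 0"
  shows "0 < a \<bullet> (q_covariance 1 f *v a)"
proof (rule ccontr)
  define m where "m = q_expectation 1 f (\<lambda>x. x)"
  note cov = covariance_bilinear[of a a, folded m_def]
  have nonneg: "AE x in lebesgue. 0 \<le> f x * ((a \<bullet> (x - m)) * (a \<bullet> (x - m)))"
    by (simp add: prob_density_nonneg[OF density])
  assume "\<not> 0 < a \<bullet> (q_covariance 1 f *v a)"
  then have "(\<integral>x. f x * ((a \<bullet> (x - m)) * (a \<bullet> (x - m))) \<partial>lebesgue) = 0"
    using integral_nonneg_AE[OF nonneg] cov by simp
  then have "AE x in lebesgue. f x * ((a \<bullet> (x - m)) * (a \<bullet> (x - m))) = 0"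
    using integral_nonneg_eq_0_iff_AE[OF cov(1) nonneg] by blast
  moreover have "AE x in lebesgue. a \<bullet> (x - m) \<noteq> 0"
  proof (rule AE_I')
    show "{x. a \<bullet> x = a \<bullet> m} \<in> null_sets lebesgue"
      using negligible_hyperplane[of a "a \<bullet> m"] assms by (simp add: negligible_iff_null_sets)
  qed (auto simp: inner_diff_right)
  ultimately have "AE x in lebesgue. f x = 0"
    by eventually_elim auto
  then have "(\<integral>x. f x \<partial>lebesgue) = 0"
    by (simp add: integral_eq_zero_AE)
  then show False by (simp add: density_integral)
qed

text \<open>The squared norm is the sum over the rows of \<open>A\<close> of squared centred
  coordinates, and each of the \<open>CARD('n)\<close> coordinates has variance 1.\<close>

lemma whitened_second_moment:
  fixes A :: "real^'n^'n"
  assumes A: "\<And>i j. A $ i \<bullet> (q_covariance 1 f *v A $ j) = of_bool (i = j)"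
  defines "m \<equiv> q_expectation 1 f (\<lambda>x. x)"
  shows "has_bochner_integral lebesgue (\<lambda>x. f x * (norm (A *v (x - m)))\<^sup>2) (real CARD('n))"
proof -
  have "(norm (A *v y))\<^sup>2 = (\<Sum>i\<in>UNIV. (A $ i \<bullet> y) * (A $ i \<bullet> y))" for y
    by (simp only: power2_norm_eq_inner matrix_mult_dot) (subst inner_vec_def, simp)
  then have eq: "f x * (norm (A *v (x - m)))\<^sup>2
      = (\<Sum>i\<in>UNIV. f x * ((A $ i \<bullet> (x - m)) * (A $ i \<bullet> (x - m))))" for x
    by (simp add: sum_distrib_left)
  have "has_bochner_integral lebesgue (\<lambda>x. f x * ((A $ i \<bullet> (x - m)) * (A $ i \<bullet> (x - m)))) 1" for i
    using covariance_bilinear[of "A $ i" "A $ i", folded m_def] A[of i i]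
    by (simp add: has_bochner_integral_iff)
  then have "has_bochner_integral lebesgue
      (\<lambda>x. \<Sum>i\<in>UNIV. f x * ((A $ i \<bullet> (x - m)) * (A $ i \<bullet> (x - m)))) (\<Sum>i\<in>(UNIV::'n set). 1)"
    by (intro has_bochner_integral_sum)
  then show ?thesis by (simp add: eq)
qed

section \<open>The bound for p > 1\<close>

text \<open>Both claims come from one whitening matrix \<open>A\<close>: positivity from
  \<open>(det A)\<^sup>2 * det S = 1\<close>, and the bound from the cross entropy of
  \<open>f\<close> relative to the Gaussian built from \<open>A\<close>.\<close>

lemma det_covariance_pos: "0 < det (q_covariance 1 f)"
  and covariance_powr_integral_ge:
    "1 < p \<Longrightarrow> ennreal (exp (- ((p - 1) * (ln (det (q_covariance 1 f)) / 2
        + real CARD('n) / 2 * (ln (2 * pi) + 1)))))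
      \<le> (\<integral>\<^sup>+x. ennreal (f x powr p) \<partial>lebesgue)"
proof -
  let ?S = "q_covariance 1 f"
  define m where "m = q_expectation 1 f (\<lambda>x. x)"
  have sym: "a \<bullet> (?S *v b) = b \<bullet> (?S *v a)" for a b
    by (simp add: covariance_bilinear mult_ac)
  obtain A :: "real^'n^'n" where A: "\<And>i j. A $ i \<bullet> (?S *v A $ j) = of_bool (i = j)"
    and det: "(det A)\<^sup>2 * det ?S = 1"
    using whitening_matrix_exists[OF sym covariance_pos_def] by blast
  from det have det_A: "det A \<noteq> 0" by auto
  show pos: "0 < det ?S"
    using det zero_le_power2[of "det A"] by (metis less_numeral_extra(1) zero_less_mult_pos det_A zero_less_power2)
  have "ln ((det A)\<^sup>2) = 2 * ln \<bar>det A\<bar>"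
    using det_A ln_realpow[of "\<bar>det A\<bar>" 2] by simp
  then have "2 * ln \<bar>det A\<bar> + ln (det ?S) = ln ((det A)\<^sup>2 * det ?S)"
    using pos det_A by (simp add: ln_mult)
  then have ln_det: "ln \<bar>det A\<bar> = - ln (det ?S) / 2"
    by (simp add: det)
  define g where "g x = \<bar>det A\<bar> * std_gaussian (A *v (x - m))" for x
  have [measurable]: "g \<in> borel_measurable lebesgue"
    unfolding g_def by (intro borel_measurable_lebesgueI) measurable
  have g_pos: "0 < g x" for x
    using det_A by (simp add: g_def std_gaussian_pos)
  have g_nn: "(\<integral>\<^sup>+x. ennreal (g x) \<partial>lebesgue) = 1"
    unfolding g_def by (rule nn_integral_gaussian[OF det_A])
  have g_int: "integrable lebesgue g"
    using g_nn by (intro integrableI_nonneg) (auto intro: less_imp_le g_pos)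
  have g_1: "(\<integral>x. g x \<partial>lebesgue) = 1"
    using g_nn by (subst integral_eq_nn_integral) (auto intro: less_imp_le g_pos)
  let ?k = "ln \<bar>det A\<bar> - real CARD('n) / 2 * ln (2 * pi)"
  have ln_g: "f x * ln (g x) = ?k * f x - f x * (norm (A *v (x - m)))\<^sup>2 / 2" for x
    using det_A std_gaussian_pos[of "A *v (x - m)"]
    by (simp add: g_def ln_mult ln_std_gaussian algebra_simps)
  \<comment> \<open>Half of this moment contributes \<open>- real CARD('n) / 2\<close> to the
    integral of \<open>f * ln g\<close>. It becomes the summand 1 next to
    \<open>ln (2 * pi)\<close>, and thus the factor e in the constant.\<close>
  have mom: "integrable lebesgue (\<lambda>x. f x * (norm (A *v (x - m)))\<^sup>2)"
      "(\<integral>x. f x * (norm (A *v (x - m)))\<^sup>2 \<partial>lebesgue) = real CARD('n)"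
    using whitened_second_moment[OF A, folded m_def] by (auto simp: has_bochner_integral_iff)
  have "integrable lebesgue (\<lambda>x. f x * ln (g x))"
    unfolding ln_g using mom density_integrable by auto
  moreover have "(\<integral>x. f x * ln (g x) \<partial>lebesgue)
      = - (ln (det ?S) / 2 + real CARD('n) / 2 * (ln (2 * pi) + 1))"
    unfolding ln_g using mom density_integrable
    by (simp add: density_integral ln_det algebra_simps)
  ultimately show "ennreal (exp (- ((p - 1) * (ln (det ?S) / 2
        + real CARD('n) / 2 * (ln (2 * pi) + 1)))))
      \<le> (\<integral>\<^sup>+x. ennreal (f x powr p) \<partial>lebesgue)" if "1 < p"
    using exp_cross_entropy_le_powr_integral[OF that density_integrable prob_density_nonneg[OF density]
        density_integral g_int g_pos g_1]
    by (simp only: mult_minus_right)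
qed

lemma renyi_entropy_le_gaussian:
  assumes "1 < p"
  shows "renyi_entropy p f \<le> ereal (1 / 2) * log_ext (ennreal (det (q_covariance 1 f)))
    + ereal (ln ((2 * pi * exp 1) powr (real CARD('n) / 2)))"
proof -
  let ?I = "\<integral>\<^sup>+x. ennreal (\<bar>f x\<bar> powr p) \<partial>lebesgue"
  define L where "L = ln (det (q_covariance 1 f)) / 2 + real CARD('n) / 2 * (ln (2 * pi) + 1)"
  \<comment> \<open>Positivity of the determinant keeps \<open>log_ext\<close> finite, so the
    right-hand side is a real number.\<close>
  have rhs: "ereal (1 / 2) * log_ext (ennreal (det (q_covariance 1 f)))
    + ereal (ln ((2 * pi * exp 1) powr (real CARD('n) / 2))) = ereal L"
    using det_covariance_pos by (simp add: log_ext_def L_def ln_powr ln_mult)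
  have ge: "ennreal (exp (- ((p - 1) * L))) \<le> ?I"
    using covariance_powr_integral_ge[OF assms] prob_density_nonneg[OF density] by (simp add: L_def)
  show ?thesis
  proof (cases ?I)
    \<comment> \<open>For \<open>p > 1\<close> the factor \<open>p / (1 - p)\<close> is negative, so
      an infinite norm gives entropy \<open>-\<infinity>\<close>.\<close>
    case top
    then show ?thesis
      using assms by (simp add: renyi_entropy_def lp_norm_def log_ext_def zero_less_divide_iff)
  next
    case (real i)
    then have i: "exp (- ((p - 1) * L)) \<le> i"
      using ge by (simp add: ennreal_le_iff)
    then have i_pos: "0 < i" by (rule less_le_trans[OF exp_gt_zero])
    then have "- ((p - 1) * L) \<le> ln i"
      using i by (simp add: ln_ge_iff)
    \<comment> \<open>Division by the negative \<open>1 - p\<close> turns the lower bound on the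
      integral into an upper bound. The factor \<open>p\<close> of the entropy cancels against the
      exponent \<open>1 / p\<close> of the norm.\<close>
    then have "ln i / (1 - p) \<le> L"
      using assms by (simp add: neg_divide_le_eq algebra_simps)
    moreover have "renyi_entropy p f = ereal (ln i / (1 - p))"
      using real i_pos assms by (simp add: renyi_entropy_def lp_norm_def log_ext_def ln_powr)
    ultimately show ?thesis unfolding rhs by simp
  qed
qed

end

section \<open>Escort densities and the case 0 < p < 1\<close>

context
  fixes f :: "real^'n \<Rightarrow> real" and p :: real
  assumes density: "prob_density f" and p: "0 < p" "p < 1"
    and norm_finite: "lp_norm p f < \<infinity>" and finite: "finite_q_covariance p f"
begin

definition powr_mass :: real where
  "powr_mass = (LINT x|lebesgue. \<bar>f x\<bar> powr p)"

definition escort :: "real^'n \<Rightarrow> real" where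
  "escort x = f x powr p / powr_mass"

lemma powr_integrable: "integrable lebesgue (\<lambda>x. \<bar>f x\<bar> powr p)"
  using norm_finite prob_density_measurable[OF density]
  by (intro integrableI_nonneg) (auto simp: lp_norm_def Let_def top.not_eq_extremum split: if_splits)

lemma nn_integral_powr: "(\<integral>\<^sup>+x. ennreal (\<bar>f x\<bar> powr p) \<partial>lebesgue) = ennreal powr_mass"
  unfolding powr_mass_def using powr_integrable by (intro nn_integral_eq_integral) auto

text \<open>Mass 0 would force \<open>f\<close> to vanish almost everywhere, although it integrates
  to 1. Positivity makes the normalization of \<open>escort\<close> meaningful.\<close>

lemma powr_mass_pos: "0 < powr_mass"
proof (rule ccontr)
  note [measurable] = prob_density_measurable[OF density]
  assume "\<not> 0 < powr_mass"
  then have "(\<integral>\<^sup>+x. ennreal (\<bar>f x\<bar> powr p) \<partial>lebesgue) = 0"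
    by (simp add: nn_integral_powr ennreal_neg)
  then have "AE x in lebesgue. ennreal (f x) = 0"
    by (subst (asm) nn_integral_0_iff_AE) auto
  then have "(\<integral>\<^sup>+x. ennreal (f x) \<partial>lebesgue) = 0"
    by (subst nn_integral_0_iff_AE) auto
  then show False using density by (simp add: prob_density_def)
qed

lemma escort_nonneg: "0 \<le> escort x"
  using powr_mass_pos by (simp add: escort_def)

lemma escort_measurable: "escort \<in> borel_measurable lebesgue"
  using prob_density_measurable[OF density] unfolding escort_def by measurable

lemma prob_density_escort: "prob_density escort"
proof -
  note [measurable] = prob_density_measurable[OF density] escort_measurable
  have "ennreal (escort x) = ennreal (\<bar>f x\<bar> powr p) * ennreal (1 / powr_mass)" for x
    using powr_mass_pos prob_density_nonneg[OF density, of x] by (simp add: escort_def flip: ennreal_mult)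
  then have "(\<integral>\<^sup>+x. ennreal (escort x) \<partial>lebesgue) = ennreal powr_mass * ennreal (1 / powr_mass)"
    by (simp add: nn_integral_multc nn_integral_powr)
  also have "\<dots> = 1"
    using powr_mass_pos by (simp flip: ennreal_mult)
  finally show ?thesis
    using escort_nonneg by (simp add: prob_density_def)
qed

lemma finite_covariance_escort: "finite_q_covariance 1 escort"
proof -
  note [measurable] = prob_density_measurable[OF density] escort_measurable
  have [measurable]: "(\<lambda>x::real^'n. (norm x)\<^sup>2) \<in> borel_measurable lebesgue"
    by (intro borel_measurable_lebesgueI) measurable
  have "ennreal ((norm x)\<^sup>2 * \<bar>escort x\<bar> powr 1)
      = ennreal ((norm x)\<^sup>2 * \<bar>f x\<bar> powr p) * ennreal (1 / powr_mass)" for x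
    using powr_mass_pos prob_density_nonneg[OF density, of x] escort_nonneg[of x]
    by (simp add: escort_def flip: ennreal_mult)
  then have "(\<integral>\<^sup>+x. ennreal ((norm x)\<^sup>2 * \<bar>escort x\<bar> powr 1) \<partial>lebesgue)
      = (\<integral>\<^sup>+x. ennreal ((norm x)\<^sup>2 * \<bar>f x\<bar> powr p) \<partial>lebesgue) * ennreal (1 / powr_mass)"
    by (simp add: nn_integral_multc)
  then show ?thesis
    using finite by (simp add: finite_q_covariance_def ennreal_mult_less_top)
qed

text \<open>\<open>powr_mass\<close> is precisely the denominator of the
  \<open>p\<close>-expectation. Applied to the identity and then to the outer product, this
  identifies the means and the covariances.\<close>

lemma q_expectation_escort: "q_expectation 1 escort g = q_expectation p f g"
proof -
  have "escort x *\<^sub>R g x = (1 / powr_mass) *\<^sub>R (\<bar>f x\<bar> powr p *\<^sub>R g x)" for x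
    using prob_density_nonneg[OF density, of x] by (simp add: escort_def)
  then have "(LINT x|lebesgue. escort x *\<^sub>R g x)
      = (1 / powr_mass) *\<^sub>R (LINT x|lebesgue. \<bar>f x\<bar> powr p *\<^sub>R g x)"
    by (simp only: integral_scaleR_right)
  then show ?thesis
    unfolding q_expectation_density[OF prob_density_escort finite_covariance_escort]
    by (simp add: q_expectation_def powr_mass_def[symmetric] inverse_eq_divide)
qed

text \<open>The power \<open>1 / p\<close> turns \<open>escort\<close> back into a multiple of
  \<open>f\<close>, whose integral is 1, so the norm of \<open>escort\<close> of order
  \<open>1 / p\<close> is \<open>1 / powr_mass\<close>. Both entropies equal
  \<open>ln powr_mass / (1 - p)\<close>.\<close>

lemma renyi_entropy_escort: "renyi_entropy (1 / p) escort = renyi_entropy p f"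
proof -
  note [measurable] = prob_density_measurable[OF density] escort_measurable
  have "ennreal (\<bar>escort x\<bar> powr (1 / p)) = ennreal (f x) * ennreal (powr_mass powr (- 1 / p))" for x
    using powr_mass_pos prob_density_nonneg[OF density, of x] p
    by (simp add: escort_def powr_divide powr_powr powr_minus_divide flip: ennreal_mult)
  then have "(\<integral>\<^sup>+x. ennreal (\<bar>escort x\<bar> powr (1 / p)) \<partial>lebesgue) = ennreal (powr_mass powr (- 1 / p))"
    using density by (simp add: nn_integral_multc prob_density_def)
  then have "renyi_entropy (1 / p) escort = ereal ((1 / p) / (1 - 1 / p) * - ln powr_mass)"
    using p powr_mass_pos by (simp add: renyi_entropy_def lp_norm_def log_ext_def ln_div powr_powr powr_minus_divide)
  also have "(1 / p) / (1 - 1 / p) * - ln powr_mass = p / (1 - p) * (ln powr_mass / p)"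
    using p by (simp add: field_simps)
  also have "ereal \<dots> = renyi_entropy p f"
    using p powr_mass_pos
    by (simp add: renyi_entropy_def lp_norm_def log_ext_def ln_powr nn_integral_powr)
  finally show ?thesis .
qed

lemma renyi_entropy_le_gaussian_escort:
  "renyi_entropy p f \<le> ereal (1 / 2) * log_ext (ennreal (det (q_covariance p f)))
    + ereal (ln ((2 * pi * exp 1) powr (real CARD('n) / 2)))"
proof -
  have "q_covariance 1 escort = q_covariance p f"
    by (simp add: q_covariance_def q_expectation_escort)
  then show ?thesis
    using renyi_entropy_le_gaussian[OF prob_density_escort finite_covariance_escort, of "1 / p"] p
    by (simp add: renyi_entropy_escort)
qed

end

theorem corollary1:
  fixes f :: "real ^ 'n \<Rightarrow> real"
  assumes "prob_density f"
  shows "let C = (2 * pi * exp 1) powr (real CARD('n) / 2) in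
    (\<forall>p. 1 < p \<and> finite_q_covariance 1 f \<longrightarrow>
       renyi_entropy p f
         \<le> ereal (1 / 2) * log_ext (ennreal (det (q_covariance 1 f))) + ereal (ln C)) \<and>
    (\<forall>p. 0 < p \<and> p < 1 \<and> lp_norm p f < \<infinity> \<and> finite_q_covariance p f \<longrightarrow>
       renyi_entropy p f
         \<le> ereal (1 / 2) * log_ext (ennreal (det (q_covariance p f))) + ereal (ln C))"
  using renyi_entropy_le_gaussian[OF assms] renyi_entropy_le_gaussian_escort[OF assms]
  unfolding Let_def by blast

end
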